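(* For all integers $r,s,k\in\mathbb{Z}$ and every integer $n\ge 0$, $$s_{n}^{(r,k)}(x)=\sum_{m=0}^{n}\binom{n}{m}s_{n-m}^{(r-s,k)}\,\mathbb{B}_{m}^{(s)}(x)$$ as polynomials in $x$.
   Context: For $k\in\mathbb{Z}$, $Li_k(x)=\sum_{n=1}^{\infty}\frac{x^n}{n^k}$ is the polylogarithm, regarded as a formal power series; $\frac{Li_k(1-e^{-t})}{1-e^{-t}}$ is then a formal power series in $t$ over $\mathbb{C}$. For $r\in\mathbb{Z}$, the Bernoulli polynomials of order $r$, $\mathbb{B}_n^{(r)}(x)$, are defined by $\left(\frac{t}{e^t-1}\right)^r e^{xt}=\sum_{n\ge0}\mathbb{B}_n^{(r)}(x)\frac{t^n}{n!}$. For $r,k\in\mathbb{Z}$, the higher-order Bernoulli and poly-Bernoulli mixed type polynomials $s_n^{(r,k)}(x)$ are defined by $\left(\frac{t}{e^t-1}\right)^r\frac{Li_k(1-e^{-t})}{1-e^{-t}}e^{xt}=\sum_{n\ge0}s_n^{(r,k)}(x)\frac{t^n}{n!}$, and $s_n^{(r,k)}=s_n^{(r,k)}(0)$. *)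

theory Defs
  imports "HOL-Computational_Algebra.Formal_Power_Series" "HOL-Computational_Algebra.Polynomial"
    Complex_Main
begin

text \<open>
  The generating functions are formal power series in \<open>t\<close> whose coefficients are polynomials
  in \<open>x\<close>, so that \<open>e^(x t)\<close> is the series with coefficients \<open>x^n / n!\<close>.
  The factors not involving \<open>x\<close> are formed over the complex numbers, where division and integer
  powers of power series are available, and are then embedded coefficientwise.
\<close>

definition const_fps :: "complex fps \<Rightarrow> complex poly fps" where
  "const_fps f = Abs_fps (\<lambda>n. [:fps_nth f n:])"

definition exp_xt :: "complex poly fps" where
  "exp_xt = Abs_fps (\<lambda>n. monom (1 / fact n) n)"

text \<open>
  Dividend and divisor both have subdegree 1, so the quotient is the true one; its constant
  coefficient is 1, so it is a unit and its negative powers are the true ones.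
\<close>

definition bernoulli_fps :: "complex fps" where
  "bernoulli_fps = fps_X / (fps_exp 1 - 1)"

definition polylog_fps :: "int \<Rightarrow> complex fps" where
  "polylog_fps k = Abs_fps (\<lambda>n. if n = 0 then 0 else 1 / (of_nat n powi k))"

text \<open>
  The inner series \<open>1 - e^(-t)\<close> has constant coefficient 0, so the composition is well defined;
  both dividend and divisor have subdegree 1.
\<close>

definition poly_bernoulli_fps :: "int \<Rightarrow> complex fps" where
  "poly_bernoulli_fps k =
     fps_compose (polylog_fps k) (1 - fps_exp (-1)) / (1 - fps_exp (-1))"

definition bernoulli_poly :: "int \<Rightarrow> nat \<Rightarrow> complex poly" where
  "bernoulli_poly r n =
     smult (fact n) (fps_nth (const_fps (bernoulli_fps powi r) * exp_xt) n)"

definition mixed_poly :: "int \<Rightarrow> int \<Rightarrow> nat \<Rightarrow> complex poly" where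
  "mixed_poly r k n =
     smult (fact n)
       (fps_nth (const_fps (bernoulli_fps powi r) * const_fps (poly_bernoulli_fps k) * exp_xt) n)"

definition mixed_number :: "int \<Rightarrow> int \<Rightarrow> nat \<Rightarrow> complex" where
  "mixed_number r k n = poly (mixed_poly r k n) 0"

end

theory Submission imports Defs begin

text \<open>Write B for \<open>bernoulli_fps\<close> and L for \<open>poly_bernoulli_fps k\<close>.
  The generating function factors as B^r L e^(xt) = (B^(r-s) L) (B^s e^(xt)). The first factor is
  free of x and generates the numbers \<open>mixed_number (r - s) k\<close>; the second generates
  the Bernoulli polynomials of order s. Comparing coefficients gives a binomial convolution. The
  point needing care is B^r = B^(r-s) B^s for exponents of any sign, which rests on B being a
  unit.\<close>

text \<open>Power series form no field, so the exponent law is derived from invertibility of the one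
  base \<open>x\<close>, by induction on \<open>b\<close> in both directions from 0.\<close>

lemma power_int_add_of_inverse:
  fixes x :: "'a :: {comm_ring_1, inverse}"
  assumes "x * inverse x = 1"
  shows "x powi (a + b) = x powi a * x powi b"
proof -
  have step: "x powi (c + 1) = x powi c * x" for c
  proof (cases "c \<ge> 0")
    case True
    then show ?thesis
      by (simp add: power_int_def nat_add_distrib)
  next
    case False
    \<comment> \<open>For negative \<open>c\<close> the power is one of \<open>inverse x\<close>;
      its extra factor cancels against \<open>x\<close>.\<close>
    then have "nat (- c) = Suc (nat (- (c + 1)))"
      by simp
    with False assms show ?thesis
      by (auto simp: power_int_def mult.commute[of _ x] simp flip: mult.assoc)
  qed
  have step': "x powi (c - 1) = x powi c * inverse x" for c
    using step[of "c - 1"] assms by (simp add: mult.assoc)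
  show ?thesis
  proof (induction b rule: int_induct[where k = 0])
    case (step1 b)
    then show ?case
      using step[of "a + b"] step[of b] by (simp add: add.assoc mult.assoc)
  next
    case (step2 b)
    then show ?case
      using step'[of "a + b"] step'[of b] by (simp add: algebra_simps)
  qed simp
qed

text \<open>Cancelling t exhibits the series as the reciprocal of (e^t - 1)/t, whose constant term
  is 1.\<close>

lemma bernoulli_fps_mult_inverse: "bernoulli_fps * inverse bernoulli_fps = 1"
proof -
  define u where "u = fps_shift 1 (fps_exp 1 - 1 :: complex fps)"
  have u0: "fps_nth u 0 = 1"
    by (simp add: u_def)
  have "fps_exp 1 - 1 = fps_X * u"
    by (rule fps_ext) (auto simp: u_def)
  then have "bernoulli_fps = (fps_X * 1) div (fps_X * u)"
    by (simp add: bernoulli_fps_def)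
  also have "\<dots> = 1 div u"
    by (rule div_mult_mult1) simp
  also have "\<dots> = inverse u"
    using u0 by (simp add: fps_divide_unit)
  finally show ?thesis
    using u0 by (metis fps_inverse_idempotent inverse_mult_eq_1 zero_neq_one)
qed

lemma const_fps_mult: "const_fps (f * g) = const_fps f * const_fps g"
proof (rule fps_ext)
  have "[:sum h A:] = (\<Sum>i\<in>A. [:h i:])" for h :: "nat \<Rightarrow> complex" and A
    by (rule poly_eqI) (simp add: coeff_sum coeff_pCons split: nat.split)
  then show "fps_nth (const_fps (f * g)) n = fps_nth (const_fps f * const_fps g) n" for n
    by (simp add: const_fps_def fps_mult_nth mult_ac)
qed

text \<open>At x = 0 only the constant term of e^(xt) survives.\<close>

lemma poly_const_fps_mult_exp_xt_0:
  "poly (fps_nth (const_fps f * exp_xt) n) 0 = fps_nth f n"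
proof -
  have "poly (fps_nth (const_fps f * exp_xt) n) 0
      = (\<Sum>i=0..n. if i = n then fps_nth f n else 0)"
    unfolding fps_mult_nth poly_sum
    by (rule sum.cong) (auto simp: const_fps_def exp_xt_def poly_monom power_0_left)
  then show ?thesis
    by simp
qed

theorem theorem9:
  fixes r s k :: int and n :: nat
  shows "mixed_poly r k n =
    (\<Sum>m=0..n. smult (of_nat (n choose m) * mixed_number (r - s) k (n - m)) (bernoulli_poly s m))"
proof -
  define P where "P = bernoulli_fps powi (r - s) * poly_bernoulli_fps k"
  define Q where "Q = const_fps (bernoulli_fps powi s) * exp_xt"
  have number: "mixed_number (r - s) k j = fact j * fps_nth P j" for j
    by (simp add: mixed_number_def mixed_poly_def P_def poly_const_fps_mult_exp_xt_0
        flip: const_fps_mult)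
  have "bernoulli_fps powi r = bernoulli_fps powi (r - s) * bernoulli_fps powi s"
    using power_int_add_of_inverse[OF bernoulli_fps_mult_inverse, of "r - s" s] by simp
  \<comment> \<open>\<open>Q\<close> stands first so that the Cauchy index \<open>m\<close> falls on
    the Bernoulli polynomial.\<close>
  then have "const_fps (bernoulli_fps powi r) * const_fps (poly_bernoulli_fps k) * exp_xt
      = Q * const_fps P"
    by (simp add: P_def Q_def const_fps_mult mult_ac)
  then have "mixed_poly r k n = smult (fact n) (\<Sum>m=0..n. fps_nth Q m * [:fps_nth P (n - m):])"
    by (simp add: mixed_poly_def fps_mult_nth const_fps_def)
  also have "\<dots> = (\<Sum>m=0..n. smult (fact n * fps_nth P (n - m)) (fps_nth Q m))"
    by (rule poly_eqI) (simp add: coeff_sum sum_distrib_left mult_ac)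
  also have "\<dots> = (\<Sum>m=0..n. smult (of_nat (n choose m) * mixed_number (r - s) k (n - m))
      (bernoulli_poly s m))"
    \<comment> \<open>The factor n! splits as the binomial coefficient times m! (n-m)!, one
      factorial for each normalised coefficient.\<close>
    by (rule sum.cong) (auto simp: number bernoulli_poly_def Q_def binomial_fact)
  finally show ?thesis .
qed

end
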